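(* In the graceful game, Bob has a winning strategy on every web graph $W(t,n)$ with $t\geq 2$ and $n\geq 3$ (no matter who starts).
   Context: The web graph $W(t,n)$ ($t\geq 2$, $n\geq 3$) has vertices $v_0$ (center), $v_1,\dots,v_n$ (pendent vertices) and $v_{in+1},\dots,v_{(i+1)n}$ for $i=1,\dots,t$, where for each $i\in\{1,\dots,t\}$ the vertices $v_{in+1},\dots,v_{(i+1)n}$ induce an $n$-cycle in this cyclic order (the $t$ concentric cycles); for each $k\in\{1,\dots,n\}$ the vertices $v_k,v_{n+k},v_{2n+k},\dots,v_{tn+k},v_0$ form a path in this order; there are no other edges. Thus $W(t,n)$ has $n(t+1)+1$ vertices and $m=n(2t+1)$ edges. A graceful labeling of a graph $G$ with $m$ edges is an injective map $f\colon V(G)\to\{0,1,\dots,m\}$ such that the induced edge labels $|f(u)-f(v)|$, $uv\in E(G)$, are pairwise distinct. The graceful game on a simple graph $G$ with $m$ edges: two players, Alice and Bob, alternately choose a free (not yet labeled) vertex and assign to it a label from $\{0,1,\dots,m\}$ not yet used. An edge both of whose endpoints are labeled gets label $|f(u)-f(v)|$; a move is legal only if after it all edge labels are pairwise distinct. Alice wins if the whole graph ends up gracefully labeled; Bob wins if he can prevent this. Either player may be the first to move. *)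

theory Defs
  imports Main
begin

(* An undirected simple graph is given by its vertex set V and its set E of
   two-element edges. *)

definition distinct_edge_labels :: "'a set set \<Rightarrow> ('a \<Rightarrow> nat) \<Rightarrow> bool" where
  "distinct_edge_labels F f \<longleftrightarrow>
     (\<forall>u v x y. {u, v} \<in> F \<and> {x, y} \<in> F \<and> {u, v} \<noteq> {x, y} \<longrightarrow>
        \<bar>int (f u) - int (f v)\<bar> \<noteq> \<bar>int (f x) - int (f y)\<bar>)"

definition graceful_labeling :: "'a set \<Rightarrow> 'a set set \<Rightarrow> ('a \<Rightarrow> nat) \<Rightarrow> bool" where
  "graceful_labeling V E f \<longleftrightarrow>
     inj_on f V \<and> f ` V \<subseteq> {0..card E} \<and> distinct_edge_labels E f"

datatype player = Alice | Bob

fun opponent :: "player \<Rightarrow> player" where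
  "opponent Alice = Bob"
| "opponent Bob = Alice"

type_synonym 'a move = "'a \<times> nat"

(* Histories list the moves played so far, most recent first, so that map_of
   turns a history into the current partial labeling. *)
type_synonym 'a history = "'a move list"

definition to_move :: "player \<Rightarrow> 'a history \<Rightarrow> player" where
  "to_move first h = (if even (length h) then first else opponent first)"

definition legal_move :: "'a set \<Rightarrow> 'a set set \<Rightarrow> 'a history \<Rightarrow> 'a move \<Rightarrow> bool" where
  "legal_move V E h mv \<longleftrightarrow>
     fst mv \<in> V - dom (map_of h) \<and>
     snd mv \<in> {0..card E} - ran (map_of h) \<and>
     (let p = map_of (mv # h) in
        distinct_edge_labels {e \<in> E. e \<subseteq> dom p} (\<lambda>v. the (p v)))"

definition game_over :: "'a set \<Rightarrow> 'a set set \<Rightarrow> 'a history \<Rightarrow> bool" where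
  "game_over V E h \<longleftrightarrow> (\<nexists>mv. legal_move V E h mv)"

definition Alice_wins :: "'a set \<Rightarrow> 'a set set \<Rightarrow> 'a history \<Rightarrow> bool" where
  "Alice_wins V E h \<longleftrightarrow>
     dom (map_of h) = V \<and> graceful_labeling V E (\<lambda>v. the (map_of h v))"

type_synonym 'a strategy = "'a history \<Rightarrow> 'a move"

inductive Bob_follows ::
  "'a set \<Rightarrow> 'a set set \<Rightarrow> player \<Rightarrow> 'a strategy \<Rightarrow> 'a history \<Rightarrow> bool"
  for V E first \<sigma> where
  start: "Bob_follows V E first \<sigma> []"
| step: "\<lbrakk>Bob_follows V E first \<sigma> h; legal_move V E h mv;
          to_move first h = Bob \<Longrightarrow> mv = \<sigma> h\<rbrakk>
         \<Longrightarrow> Bob_follows V E first \<sigma> (mv # h)"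

(* The first conjunct forces Bob to move legally as long as he can: without it,
   a strategy could win vacuously by proposing an illegal move. *)
definition winning_strategy_for_Bob ::
  "'a set \<Rightarrow> 'a set set \<Rightarrow> player \<Rightarrow> 'a strategy \<Rightarrow> bool" where
  "winning_strategy_for_Bob V E first \<sigma> \<longleftrightarrow>
     (\<forall>h. Bob_follows V E first \<sigma> h \<and> to_move first h = Bob \<and> \<not> game_over V E h
            \<longrightarrow> legal_move V E h (\<sigma> h)) \<and>
     (\<forall>h. Bob_follows V E first \<sigma> h \<and> game_over V E h \<longrightarrow> \<not> Alice_wins V E h)"

(* The web graph W(t,n); the number j stands for the vertex v_j. *)

definition web_vertices :: "nat \<Rightarrow> nat \<Rightarrow> nat set" where
  "web_vertices t n = {0..n * (t + 1)}"

definition web_cycle_edges :: "nat \<Rightarrow> nat \<Rightarrow> nat set set" where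
  "web_cycle_edges t n =
     {{i * n + k, i * n + k + 1} | i k. i \<in> {1..t} \<and> k \<in> {1..<n}} \<union>
     {{(i + 1) * n, i * n + 1} | i. i \<in> {1..t}}"

definition web_path_edges :: "nat \<Rightarrow> nat \<Rightarrow> nat set set" where
  "web_path_edges t n =
     {{i * n + k, (i + 1) * n + k} | i k. i \<in> {0..<t} \<and> k \<in> {1..n}} \<union>
     {{t * n + k, 0} | k. k \<in> {1..n}}"

definition web_edges :: "nat \<Rightarrow> nat \<Rightarrow> nat set set" where
  "web_edges t n = web_cycle_edges t n \<union> web_path_edges t n"

end

theory Submission imports Defs begin

text \<open>
  A graceful labeling of a graph with \<open>m\<close> edges realises every edge label \<open>1, \<dots>, m\<close>. Label \<open>m\<close>
  forces \<open>0\<close> and \<open>m\<close> onto adjacent vertices, and label \<open>m - 1\<close> forces \<open>0\<close> next to \<open>m - 1\<close> or \<open>1\<close>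
  next to \<open>m\<close>. If one of \<open>0, m\<close> is used and Bob is to move, he therefore wins by putting the
  other one far away. If Alice does not open with \<open>0\<close> or \<open>m\<close>, Bob puts \<open>0\<close> on a pendent vertex; Alice has to
  answer with \<open>m\<close> on its only neighbour, and then Bob wins by putting \<open>1\<close> far away. If Alice
  opens with \<open>1\<close>, Bob plays the complementary labels \<open>m, 0, m - 1\<close> instead. Vertices far from the
  at most three labeled ones exist because the \<open>n\<close> pendent vertices and the center have pairwise
  disjoint closed neighbourhoods.
\<close>

section \<open>From an invariant to a winning strategy\<close>

lemma to_move_Cons: "to_move first (mv # h) = opponent (to_move first h)"
  by (cases first) (auto simp: to_move_def)

text \<open>Choosing at each turn of Bob a legal move that preserves \<open>I\<close> keeps
  \<open>I\<close> true in every history that follows \<open>\<sigma>\<close>.\<close>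

lemma winning_strategy_for_Bob_if_invariant:
  assumes "I []"
    and Alice: "\<And>h mv. \<lbrakk>I h; to_move first h = Alice; legal_move V E h mv\<rbrakk> \<Longrightarrow> I (mv # h)"
    and Bob: "\<And>h. \<lbrakk>I h; to_move first h = Bob; \<not> game_over V E h\<rbrakk>
                \<Longrightarrow> \<exists>mv. legal_move V E h mv \<and> I (mv # h)"
    and no_win: "\<And>h. I h \<Longrightarrow> \<not> Alice_wins V E h"
  shows "\<exists>\<sigma>. winning_strategy_for_Bob V E first \<sigma>"
proof -
  define \<sigma> where "\<sigma> h = (SOME mv. legal_move V E h mv \<and> I (mv # h))" for h
  have \<sigma>: "legal_move V E h (\<sigma> h) \<and> I (\<sigma> h # h)"
    if "I h" "to_move first h = Bob" "\<not> game_over V E h" for h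
    unfolding \<sigma>_def using Bob[OF that] by (rule someI_ex)
  have inv: "I h" if "Bob_follows V E first \<sigma> h" for h
    using that
  proof induction
    case start
    show ?case by fact
  next
    case (step h mv)
    show ?case
    proof (cases "to_move first h")
      case Alice
      then show ?thesis using assms(2) step by blast
    next
      case Bob
      moreover have "\<not> game_over V E h" using step unfolding game_over_def by blast
      ultimately show ?thesis using \<sigma>[of h] step by simp
    qed
  qed
  then show ?thesis
    unfolding winning_strategy_for_Bob_def using \<sigma> no_win by blast
qed

section \<open>Consistent and doomed positions\<close>

definition consistent :: "'a set set \<Rightarrow> 'a history \<Rightarrow> bool" where
  "consistent E h \<longleftrightarrow>
     distinct_edge_labels {e \<in> E. e \<subseteq> dom (map_of h)} (\<lambda>v. the (map_of h v))"

text \<open>Bob's goal: once no graceful labeling extends the position, any legal continuation suits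
  Bob. Free vertices impose no constraint.\<close>

definition doomed :: "'a set \<Rightarrow> 'a set set \<Rightarrow> 'a history \<Rightarrow> bool" where
  "doomed V E h \<longleftrightarrow>
     (\<forall>f. graceful_labeling V E f \<longrightarrow> (\<exists>v x. map_of h v = Some x \<and> f v \<noteq> x))"

lemma consistent_Nil: "consistent E []"
  by (auto simp: consistent_def distinct_edge_labels_def)

lemma consistent_Cons: "legal_move V E h mv \<Longrightarrow> consistent E (mv # h)"
  by (simp add: legal_move_def consistent_def Let_def)

lemma dom_Cons: "legal_move V E h mv \<Longrightarrow> dom (map_of h) \<subseteq> V \<Longrightarrow> dom (map_of (mv # h)) \<subseteq> V"
  by (auto simp: legal_move_def)

text \<open>A legal move labels a free vertex, so labels already placed never change.\<close>

lemma doomed_Cons: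
  assumes "doomed V E h" "legal_move V E h mv"
  shows "doomed V E (mv # h)"
proof -
  have "map_of (mv # h) v = Some x" if "map_of h v = Some x" for v x
    using assms(2) that by (auto simp: legal_move_def)
  then show ?thesis using assms(1) unfolding doomed_def by blast
qed

lemma doomed_not_Alice_wins:
  assumes "doomed V E h"
  shows "\<not> Alice_wins V E h"
proof
  assume "Alice_wins V E h"
  then obtain v x where "map_of h v = Some x" "the (map_of h v) \<noteq> x"
    using assms unfolding doomed_def Alice_wins_def by blast
  then show False by simp
qed

section \<open>Edge labels of graceful labelings\<close>

locale simple_graph =
  fixes V :: "'a set" and E :: "'a set set"
  assumes finite_E: "finite E"
    and edgeE: "e \<in> E \<Longrightarrow> \<exists>x\<in>V. \<exists>y\<in>V. x \<noteq> y \<and> e = {x, y}"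
begin

text \<open>Pigeonhole: the \<open>card E\<close> distinct edge labels lie in
  \<open>{1..card E}\<close>, since injectivity excludes 0, so every value occurs.\<close>

lemma graceful_edge_label:
  assumes f: "graceful_labeling V E f" and k: "1 \<le> k" "k \<le> card E"
  shows "\<exists>x y. {x, y} \<in> E \<and> f y = f x + k"
proof -
  \<comment> \<open>The edge label as a function of the edge as a set, without ordering its
    ends.\<close>
  define g where "g e = Max (f ` e) - Min (f ` e)" for e
  have g: "int (g {x, y}) = \<bar>int (f x) - int (f y)\<bar>" for x y
    by (auto simp: g_def max_def min_def)
  have inj_f: "inj_on f V" and le: "\<And>v. v \<in> V \<Longrightarrow> f v \<le> card E"
    and dist: "distinct_edge_labels E f"
    using f by (auto simp: graceful_labeling_def)
  have "inj_on g E"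
  proof (rule inj_onI, rule ccontr)
    fix e e' assume *: "e \<in> E" "e' \<in> E" "g e = g e'" "e \<noteq> e'"
    obtain x y where e: "e = {x, y}" using edgeE *(1) by blast
    obtain x' y' where e': "e' = {x', y'}" using edgeE *(2) by blast
    show False using * dist g[of x y] g[of x' y'] unfolding e e' distinct_edge_labels_def by metis
  qed
  moreover have "g ` E \<subseteq> {1..card E}"
  proof
    fix l assume "l \<in> g ` E"
    then obtain x y where xy: "x \<in> V" "y \<in> V" "x \<noteq> y" "l = g {x, y}" using edgeE by blast
    then have "f x \<noteq> f y" using inj_f by (auto dest: inj_onD)
    then show "l \<in> {1..card E}" using xy g[of x y] le[of x] le[of y] by auto
  qed
  ultimately have "g ` E = {1..card E}"
    by (intro card_subset_eq) (auto simp: card_image)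
  then have "k \<in> g ` E" using k by auto
  then obtain x y where xy: "{x, y} \<in> E" "k = g {x, y}" using edgeE by blast
  then have "f y = f x + k \<or> f x = f y + k" using g[of x y] by linarith
  then show ?thesis using xy(1) by (metis insert_commute)
qed

lemma edge_vertices: "{x, y} \<in> E \<Longrightarrow> x \<in> V \<and> y \<in> V"
  using edgeE by (metis doubleton_eq_iff)

text \<open>Edge label \<open>card E\<close> must occur, and only the two extreme labels differ by
  that much.\<close>

lemma graceful_extremes_adjacent:
  assumes f: "graceful_labeling V E f" and "card E > 0"
    and "u \<in> V" "v \<in> V" "f u = 0" "f v = card E"
  shows "{u, v} \<in> E"
proof -
  obtain x y where xy: "{x, y} \<in> E" "f y = f x + card E"
    using graceful_edge_label[OF f, of "card E"] assms by auto
  have inj_f: "inj_on f V" and le: "\<And>v. v \<in> V \<Longrightarrow> f v \<le> card E"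
    using f by (auto simp: graceful_labeling_def)
  have "f x = f u" "f y = f v" using xy le[of y] edge_vertices assms by auto
  then show ?thesis using xy edge_vertices inj_f assms by (metis inj_onD)
qed

text \<open>Two labels differing by \<open>card E - 1\<close> are either 0 and
  \<open>card E - 1\<close>, or 1 and \<open>card E\<close>.\<close>

lemma graceful_next_to_extremes:
  assumes f: "graceful_labeling V E f" and "card E > 1"
    and "u \<in> V" "v \<in> V" "f u = 0" "f v = card E"
  shows "(\<exists>y\<in>V. {u, y} \<in> E \<and> f y = card E - 1) \<or> (\<exists>x\<in>V. {x, v} \<in> E \<and> f x = 1)"
proof -
  obtain x y where xy: "{x, y} \<in> E" "f y = f x + (card E - 1)"
    using graceful_edge_label[OF f, of "card E - 1"] assms(2) by force
  have inj_f: "inj_on f V" and le: "\<And>v. v \<in> V \<Longrightarrow> f v \<le> card E"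
    using f by (auto simp: graceful_labeling_def)
  have "f x = f u \<and> f y = card E - 1 \<or> f x = 1 \<and> f y = f v"
    using xy le[of y] edge_vertices[of x y] assms by auto
  then show ?thesis using xy edge_vertices inj_f assms by (metis inj_onD)
qed

text \<open>Every edge at \<open>u\<close> has an unlabeled other end, so the move completes no edge
  and creates no edge label.\<close>

lemma legal_move_isolated:
  assumes "consistent E h" and u: "u \<in> V" "u \<notin> dom (map_of h)"
    and isol: "\<And>x. x \<in> dom (map_of h) \<Longrightarrow> {u, x} \<notin> E"
    and "l \<le> card E" "l \<notin> ran (map_of h)"
  shows "legal_move V E h (u, l)"
proof -
  have "e \<subseteq> dom (map_of h)" if "e \<in> E" "e \<subseteq> insert u (dom (map_of h))" for e
  proof (rule ccontr)
    assume "\<not> ?thesis"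
    then have "u \<in> e" using that by blast
    then obtain x where "e = {u, x}" "x \<noteq> u" using edgeE[OF \<open>e \<in> E\<close>] by blast
    then show False using \<open>e \<in> E\<close> \<open>e \<subseteq> _\<close> isol[of x] by blast
  qed
  then have eq: "{e \<in> E. e \<subseteq> insert u (dom (map_of h))} = {e \<in> E. e \<subseteq> dom (map_of h)}"
    by auto
  have "distinct_edge_labels {e \<in> E. e \<subseteq> dom (map_of h)} (\<lambda>v. the (map_of ((u, l) # h) v))"
    unfolding distinct_edge_labels_def
  proof (intro allI impI)
    fix a b c d
    assume *: "{a, b} \<in> {e \<in> E. e \<subseteq> dom (map_of h)} \<and> {c, d} \<in> {e \<in> E. e \<subseteq> dom (map_of h)}
      \<and> {a, b} \<noteq> {c, d}"
    then have "a \<noteq> u" "b \<noteq> u" "c \<noteq> u" "d \<noteq> u" using u(2) by auto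
    then show "\<bar>int (the (map_of ((u, l) # h) a)) - int (the (map_of ((u, l) # h) b))\<bar>
        \<noteq> \<bar>int (the (map_of ((u, l) # h) c)) - int (the (map_of ((u, l) # h) d))\<bar>"
      using * assms(1) unfolding consistent_def distinct_edge_labels_def by simp
  qed
  then show ?thesis using assms eq by (simp add: legal_move_def Let_def)
qed

end

section \<open>Bob's strategy on graphs with enough far vertices\<close>

text \<open>At most one vertex is labeled when Bob opens on a leaf and at most three at his decisive
  move; hence the bounds on \<open>card L\<close>. Three edges ensure that 1 differs from
  \<open>card E - 1\<close>.\<close>

locale Bob_graph = simple_graph V E for V :: "'a set" and E :: "'a set set" +
  assumes card_E: "card E \<ge> 3"
    and far_vertex: "finite L \<Longrightarrow> card L \<le> 3 \<Longrightarrow> \<exists>u\<in>V - L. \<forall>x\<in>L. {u, x} \<notin> E"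
    and far_leaf: "finite L \<Longrightarrow> card L \<le> 1 \<Longrightarrow>
      \<exists>p\<in>V - L. (\<forall>x\<in>L. {p, x} \<notin> E) \<and> (\<exists>w. \<forall>x. {p, x} \<in> E \<longrightarrow> x = w)"
begin

text \<open>Bob's opening label, Alice's forced answer, and Bob's decisive label.\<close>

definition attack :: "nat \<Rightarrow> nat \<Rightarrow> nat \<Rightarrow> bool" where
  "attack a b c \<longleftrightarrow> (a, b, c) \<in> {(0, card E, 1), (card E, 0, card E - 1)}"

text \<open>An isolated \<open>p\<close> qualifies too, with any \<open>w\<close>; membership of
  \<open>w\<close> in \<open>V\<close> is stated separately.\<close>

definition leaf_at :: "'a \<Rightarrow> 'a \<Rightarrow> bool" where
  "leaf_at p w \<longleftrightarrow> p \<in> V \<and> (\<forall>x. {p, x} \<in> E \<longrightarrow> x = w)"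

lemma doomed_extremes:
  assumes "attack a b c" "u \<in> V" "v \<in> V" "map_of h u = Some a" "map_of h v = Some b"
    "{u, v} \<notin> E"
  shows "doomed V E h"
  unfolding doomed_def
proof (intro allI impI, rule ccontr)
  fix f assume f: "graceful_labeling V E f" and "\<nexists>v x. map_of h v = Some x \<and> f v \<noteq> x"
  then have "f u = a" "f v = b" using assms by blast+
  then show False
    using graceful_extremes_adjacent[OF f, of u v] graceful_extremes_adjacent[OF f, of v u]
      assms card_E by (auto simp: attack_def insert_commute)
qed

text \<open>Edge label \<open>card E - 1\<close> cannot arise: it needs a neighbor of
  \<open>p\<close> other than \<open>w\<close>, or the label \<open>c\<close> next to
  \<open>w\<close>, but \<open>c\<close> sits on \<open>u\<close>.\<close>

lemma doomed_leaf:
  assumes "attack a b c" "leaf_at p w" "w \<in> V" "u \<in> V" "map_of h p = Some a"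
    "map_of h w = Some b" "map_of h u = Some c" "{u, w} \<notin> E"
  shows "doomed V E h"
  unfolding doomed_def
proof (intro allI impI, rule ccontr)
  fix f assume f: "graceful_labeling V E f" and "\<nexists>v x. map_of h v = Some x \<and> f v \<noteq> x"
  then have fv: "f p = a" "f w = b" "f u = c" using assms by blast+
  have inj_f: "inj_on f V" using f by (simp add: graceful_labeling_def)
  have p: "p \<in> V" and leaf: "\<And>x. {p, x} \<in> E \<Longrightarrow> x = w"
    using assms(2) by (auto simp: leaf_at_def)
  have "(\<exists>y\<in>V. {p, y} \<in> E \<and> f y \<noteq> b) \<or> (\<exists>x\<in>V. {x, w} \<in> E \<and> f x = c)"
    using assms(1) unfolding attack_def
  proof (elim insertE emptyE)
    assume "(a, b, c) = (0, card E, 1)"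
    then show ?thesis
      using graceful_next_to_extremes[OF f _ p assms(3)] fv card_E by fastforce
  next
    assume "(a, b, c) = (card E, 0, card E - 1)"
    then show ?thesis
      using graceful_next_to_extremes[OF f _ assms(3) p] fv card_E
      by (fastforce simp: insert_commute)
  qed
  then show False
  proof (elim disjE bexE conjE)
    fix y assume "{p, y} \<in> E" "f y \<noteq> b"
    then show False using leaf fv by blast
  next
    fix x assume "x \<in> V" "{x, w} \<in> E" "f x = c"
    then show False using inj_onD[OF inj_f, of x u] fv assms by simp
  qed
qed

text \<open>The first two disjuncts are the positions before Bob's opening. After it, Bob to move either
  still has the label \<open>b\<close> at his disposal or Alice has answered with \<open>b\<close> next to the leaf.\<close>

definition undecided :: "player \<Rightarrow> 'a history \<Rightarrow> bool" where
  "undecided first h \<longleftrightarrow>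
     h = [] \<or> length h = 1 \<and> to_move first h = Bob \<or>
     (\<exists>p w a b c. attack a b c \<and> leaf_at p w \<and> map_of h p = Some a \<and>
        (to_move first h = Alice \<and> length h \<le> 2 \<and>
           b \<notin> ran (map_of h) \<and> c \<notin> ran (map_of h) \<or>
         to_move first h = Bob \<and> length h \<le> 3 \<and>
           (b \<notin> ran (map_of h) \<or> w \<in> V \<and> map_of h w = Some b \<and> c \<notin> ran (map_of h))))"

definition Bob_invariant :: "player \<Rightarrow> 'a history \<Rightarrow> bool" where
  "Bob_invariant first h \<longleftrightarrow>
     consistent E h \<and> dom (map_of h) \<subseteq> V \<and> (doomed V E h \<or> undecided first h)"

lemma attackD:
  "attack a b c \<Longrightarrow> a \<noteq> b \<and> c \<noteq> a \<and> c \<noteq> b \<and> a \<le> card E \<and> b \<le> card E \<and> c \<le> card E"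
  using card_E by (auto simp: attack_def)

text \<open>Only \<open>w\<close> can be adjacent to \<open>p\<close>, so \<open>b\<close> on any
  other vertex dooms the position. Otherwise Bob still has a decisive move.\<close>

lemma Alice_step:
  assumes und: "undecided first h" and turn: "to_move first h = Alice"
    and legal: "legal_move V E h mv"
  shows "doomed V E (mv # h) \<or> undecided first (mv # h)"
proof (cases "h = []")
  case True
  then show ?thesis using turn by (simp add: undecided_def to_move_Cons)
next
  case False
  then obtain p w a b c where *: "attack a b c" "leaf_at p w" "map_of h p = Some a"
      "length h \<le> 2" "b \<notin> ran (map_of h)" "c \<notin> ran (map_of h)"
    using und turn by (auto simp: undecided_def)
  obtain y z where mv: "mv = (y, z)" by (cases mv)
  have y: "y \<in> V" "map_of h y = None" "p \<noteq> y" using legal *(3) by (auto simp: mv legal_move_def)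
  have p: "map_of (mv # h) p = Some a" using * y by (simp add: mv)
  have ran: "ran (map_of (mv # h)) = insert z (ran (map_of h))" using y by (simp add: mv)
  have turn': "to_move first (mv # h) = Bob" using turn by (simp add: to_move_Cons)
  consider "z \<noteq> b" | "z = b" "y = w" | "z = b" "y \<noteq> w" by blast
  then show ?thesis
  proof cases
    case 1
    \<comment> \<open>Alice may have used \<open>c\<close>; as long as \<open>b\<close> is free, Bob
      does not need \<open>c\<close>.\<close>
    then have "b \<notin> ran (map_of (mv # h))" using * ran by simp
    then show ?thesis unfolding undecided_def using * p turn'
      by (metis Suc_le_mono length_Cons numeral_3_eq_3 numeral_2_eq_2)
  next
    case 2
    then have "w \<in> V \<and> map_of (mv # h) w = Some b \<and> c \<notin> ran (map_of (mv # h))"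
      using * y ran attackD[OF *(1)] by (simp add: mv)
    moreover have "length (mv # h) \<le> 3" using * by simp
    ultimately show ?thesis unfolding undecided_def using *(1,2) p turn' by blast
  next
    case 3
    then have "doomed V E (mv # h)"
      using * y p by (intro doomed_extremes[of a b c p y]) (auto simp: mv leaf_at_def)
    then show ?thesis ..
  qed
qed

text \<open>Gives Bob a place for his decisive label, and also shows that an undecided position is
  never complete.\<close>

lemma isolated_vertex:
  assumes "undecided first h"
  obtains u where "u \<in> V" "u \<notin> dom (map_of h)" "\<And>x. x \<in> dom (map_of h) \<Longrightarrow> {u, x} \<notin> E"
proof -
  have "length h \<le> 3" using assms by (auto simp: undecided_def)
  then have "card (dom (map_of h)) \<le> 3"
    using card_length[of "map fst h"] by (simp add: dom_map_of_conv_image_fst)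
  then show ?thesis using far_vertex[OF finite_dom_map_of] that by blast
qed

lemma Bob_step:
  assumes und: "undecided first h" and turn: "to_move first h = Bob" and cons: "consistent E h"
    and dom: "dom (map_of h) \<subseteq> V"
  shows "\<exists>mv. legal_move V E h mv \<and> (doomed V E (mv # h) \<or> undecided first (mv # h))"
proof -
  obtain u where u: "u \<in> V" "u \<notin> dom (map_of h)" "\<And>x. x \<in> dom (map_of h) \<Longrightarrow> {u, x} \<notin> E"
    using isolated_vertex[OF und] by blast
  note legal = legal_move_isolated[OF cons u]
  \<comment> \<open>Putting \<open>b\<close> on the far vertex \<open>u\<close> separates the labels
    0 and \<open>card E\<close>.\<close>
  have extreme: ?thesis
    if "attack a b c" "v \<in> V" "map_of h v = Some a" "b \<notin> ran (map_of h)" for a b c v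
  proof (intro exI conjI disjI1)
    show "legal_move V E h (u, b)" using legal attackD that by blast
    show "doomed V E ((u, b) # h)"
      using that u u(3)[of v] by (intro doomed_extremes[of a b c v u]) (auto simp: insert_commute)
  qed
  consider (early) "length h \<le> 1"
    | (late) p w a b c where "attack a b c" "leaf_at p w" "map_of h p = Some a"
        "b \<notin> ran (map_of h) \<or> w \<in> V \<and> map_of h w = Some b \<and> c \<notin> ran (map_of h)"
    using und turn unfolding undecided_def by fastforce
  then show ?thesis
  proof cases
    case late
    show ?thesis
    proof (cases "b \<in> ran (map_of h)")
      case False
      then show ?thesis using extreme late by (auto simp: leaf_at_def)
    next
      case True
      then have w: "w \<in> V" "map_of h w = Some b" "c \<notin> ran (map_of h)" using late by auto
      have "legal_move V E h (u, c)" using legal attackD late(1) w by blast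
      moreover have "doomed V E ((u, c) # h)"
        using u late w by (intro doomed_leaf[of a b c p w u]) auto
      ultimately show ?thesis by blast
    qed
  next
    case early
    have card_dom: "card (dom (map_of h)) \<le> 1"
      using early card_length[of "map fst h"] by (simp add: dom_map_of_conv_image_fst)
    \<comment> \<open>\<open>x\<close> is the label of Alice's opening move; it is arbitrary if
      \<open>h\<close> is empty, hence the test \<open>x \<in> ran (map_of h)\<close> below.\<close>
    obtain x where x: "ran (map_of h) \<subseteq> {x}"
      using early by (cases h) (auto simp: ran_def)
    obtain p w where p: "p \<notin> dom (map_of h)" "leaf_at p w"
        "\<And>x. x \<in> dom (map_of h) \<Longrightarrow> {p, x} \<notin> E"
      using far_leaf[OF finite_dom_map_of card_dom] unfolding leaf_at_def by blast
    show ?thesis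
    proof (cases "x \<in> ran (map_of h) \<and> (x = 0 \<or> x = card E)")
      case True
      then obtain v where v: "map_of h v = Some x" by (auto simp: ran_def)
      have "\<exists>b c. attack x b c" using True by (auto simp: attack_def)
      then obtain b c where "attack x b c" by blast
      moreover have "b \<notin> ran (map_of h)" using attackD[OF calculation] x by auto
      ultimately show ?thesis using extreme v dom by blast
    next
      case False
      \<comment> \<open>The attack with 0 on the leaf is blocked only by \<open>x = 1\<close>; the
        complementary one then avoids \<open>x\<close> because
        \<open>card E - 1 \<ge> 2\<close>.\<close>
      have "\<exists>a b c. attack a b c \<and> {a, b, c} \<inter> ran (map_of h) = {}"
      proof (cases "x = 1")
        case True
        then have "attack (card E) 0 (card E - 1)" "{card E, 0, card E - 1} \<inter> ran (map_of h) = {}"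
          using x card_E by (auto simp: attack_def)
        then show ?thesis by blast
      next
        case neq: False
        then have "attack 0 (card E) 1" "{0, card E, 1} \<inter> ran (map_of h) = {}"
          using x False by (auto simp: attack_def)
        then show ?thesis by blast
      qed
      then obtain a b c where abc: "attack a b c" "{a, b, c} \<inter> ran (map_of h) = {}" by blast
      have "legal_move V E h (p, a)"
        using legal_move_isolated[OF cons _ p(1,3)] p(2) attackD[OF abc(1)] abc(2)
        by (auto simp: leaf_at_def)
      moreover have "undecided first ((p, a) # h)"
      proof -
        have "to_move first ((p, a) # h) = Alice" using turn by (simp add: to_move_Cons)
        moreover have "ran (map_of ((p, a) # h)) = insert a (ran (map_of h))"
          using p(1) by (simp add: domIff)
        then have "b \<notin> ran (map_of ((p, a) # h))" "c \<notin> ran (map_of ((p, a) # h))"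
          using abc attackD[OF abc(1)] by auto
        moreover have "map_of ((p, a) # h) p = Some a" "length ((p, a) # h) \<le> 2"
          using early by auto
        ultimately show ?thesis unfolding undecided_def using abc(1) p(2) by blast
      qed
      ultimately show ?thesis by blast
    qed
  qed
qed

theorem Bob_wins: "\<exists>\<sigma>. winning_strategy_for_Bob V E first \<sigma>"
proof (rule winning_strategy_for_Bob_if_invariant)
  show "Bob_invariant first []"
    by (simp add: Bob_invariant_def consistent_Nil undecided_def)
next
  fix h mv assume "Bob_invariant first h" "to_move first h = Alice" and legal: "legal_move V E h mv"
  then have "dom (map_of h) \<subseteq> V" "doomed V E (mv # h) \<or> undecided first (mv # h)"
    unfolding Bob_invariant_def using doomed_Cons Alice_step by blast+
  then show "Bob_invariant first (mv # h)"
    unfolding Bob_invariant_def using consistent_Cons[OF legal] dom_Cons[OF legal] by blast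
next
  fix h assume inv: "Bob_invariant first h" and turn: "to_move first h = Bob"
    and "\<not> game_over V E h"
  then have "\<exists>mv. legal_move V E h mv" by (simp only: game_over_def not_not)
  \<comment> \<open>In a doomed position any legal move will do.\<close>
  then obtain mv where legal: "legal_move V E h mv"
    and "doomed V E (mv # h) \<or> undecided first (mv # h)"
    using inv turn doomed_Cons Bob_step[of first h] unfolding Bob_invariant_def by metis
  then show "\<exists>mv. legal_move V E h mv \<and> Bob_invariant first (mv # h)"
    using inv consistent_Cons[OF legal] dom_Cons[OF legal] unfolding Bob_invariant_def by blast
next
  fix h assume inv: "Bob_invariant first h"
  show "\<not> Alice_wins V E h"
  proof (cases "doomed V E h")
    case True
    then show ?thesis by (rule doomed_not_Alice_wins)
  next
    case False
    then have "undecided first h" using inv by (simp add: Bob_invariant_def)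
    then show ?thesis
    proof (rule isolated_vertex)
      fix u assume "u \<in> V" "u \<notin> dom (map_of h)"
      then show ?thesis unfolding Alice_wins_def by blast
    qed
  qed
qed

end

section \<open>Far vertices and leaves in web graphs\<close>

lemma web_edgeE:
  assumes "e \<in> web_edges t n"
  obtains (cycle) i k where "i \<in> {1..t}" "k \<in> {1..<n}" "e = {i * n + k, i * n + k + 1}"
    | (closing) i where "i \<in> {1..t}" "e = {(i + 1) * n, i * n + 1}"
    | (spoke) i k where "i \<in> {0..<t}" "k \<in> {1..n}" "e = {i * n + k, (i + 1) * n + k}"
    | (center) k where "k \<in> {1..n}" "e = {t * n + k, 0}"
  using assms unfolding web_edges_def web_cycle_edges_def web_path_edges_def by blast

text \<open>Apart from the innermost index \<open>i = 0\<close> of the spokes, every edge has its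
  ends beyond \<open>n\<close> or at the center 0.\<close>

lemma web_pendent_edge:
  assumes "t > 0" "k \<in> {1..n}" "{k, x} \<in> web_edges t n"
  shows "x = n + k"
proof -
  have large: "n < i * n + j" if "i > 0" "j > 0" for i j
    using that by (cases i) auto
  show ?thesis
    using assms(3)
  proof (cases rule: web_edgeE)
    case (cycle i j)
    then show ?thesis using large[of i j] large[of i "j + 1"] assms(2)
      by (auto simp: doubleton_eq_iff)
  next
    case (closing i)
    then show ?thesis using large[of i n] large[of i 1] assms(2)
      by (auto simp: doubleton_eq_iff)
  next
    case (spoke i j)
    then show ?thesis using large[of i j] large[of "i + 1" j] assms(2)
      by (cases "i = 0") (auto simp: doubleton_eq_iff)
  next
    case (center j)
    then show ?thesis using large[of t j] assms(1,2) by (auto simp: doubleton_eq_iff)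
  qed
qed

lemma web_center_edge:
  assumes "n > 0" "{0, x} \<in> web_edges t n"
  shows "\<exists>k\<in>{1..n}. x = t * n + k"
  using assms unfolding web_edges_def web_cycle_edges_def web_path_edges_def
  by (auto simp: doubleton_eq_iff)

text \<open>Intended for \<open>c \<le> n\<close> only, that is, for the center and the pendent
  vertices.\<close>

definition closed_nbhd :: "nat \<Rightarrow> nat \<Rightarrow> nat \<Rightarrow> nat set" where
  "closed_nbhd t n c = (if c = 0 then insert 0 {t * n + 1..t * n + n} else {c, n + c})"

text \<open>The sets are pairwise disjoint, so if all of them met \<open>L\<close>, picking a common
  point for each would inject \<open>S\<close> into \<open>L\<close>.\<close>

lemma closed_nbhd_avoiding:
  assumes "t \<ge> 2" "n > 0" "S \<subseteq> {0..n}" "finite L" "card L < card S"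
  shows "\<exists>c\<in>S. closed_nbhd t n c \<inter> L = {}"
proof (rule ccontr)
  assume "\<not> ?thesis"
  then have "\<forall>c\<in>S. \<exists>x. x \<in> closed_nbhd t n c \<and> x \<in> L" by auto
  then obtain g where g: "\<And>c. c \<in> S \<Longrightarrow> g c \<in> closed_nbhd t n c \<and> g c \<in> L"
    unfolding bchoice_iff by blast
  \<comment> \<open>By \<open>t \<ge> 2\<close>, the neighbors of pendent vertices, at most
    \<open>2 * n\<close>, lie below those of the center, above \<open>t * n\<close>.\<close>
  obtain q where q: "t * n = 2 * n + q"
    using assms(1) by (metis le_Suc_ex mult_le_mono1)
  have "inj_on g S"
  proof (rule inj_onI)
    \<comment> \<open>Disjointness in explicit form: any element of the set determines
      \<open>c\<close>.\<close>
    have decode: "c = (if x = 0 \<or> x > t * n then 0 else if x \<le> n then x else x - n)"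
      if "c \<in> S" "x \<in> closed_nbhd t n c" for c x
    proof -
      have "c \<le> n" using that assms by auto
      then show ?thesis using that by (auto simp: q closed_nbhd_def split: if_splits)
    qed
    fix c d assume "c \<in> S" "d \<in> S" "g c = g d"
    then show "c = d" using decode g by metis
  qed
  then have "card S \<le> card L" using g assms by (intro card_inj_on_le[of g]) auto
  then show False using assms by simp
qed

lemma web_vertex: "i \<le> t \<Longrightarrow> k \<le> n \<Longrightarrow> i * n + k \<in> web_vertices t n"
  using add_mono[OF mult_le_mono1[of i t n], of k n]
  by (simp add: web_vertices_def algebra_simps)

lemma web_edge_vertices:
  assumes "e \<in> web_edges t n" "n \<ge> 2"
  shows "\<exists>x\<in>web_vertices t n. \<exists>y\<in>web_vertices t n. x \<noteq> y \<and> e = {x, y}"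
  using assms(1)
proof (cases rule: web_edgeE)
  case (cycle i k)
  then show ?thesis using web_vertex[of i t k n] web_vertex[of i t "k + 1" n]
    by (intro bexI[of _ "i * n + k"] bexI[of _ "i * n + (k + 1)"]) auto
next
  case (closing i)
  then show ?thesis using web_vertex[of i t n n] web_vertex[of i t 1 n] assms(2)
    by (intro bexI[of _ "i * n + n"] bexI[of _ "i * n + 1"]) (auto simp: add.commute)
next
  case (spoke i k)
  then show ?thesis using web_vertex[of i t k n] web_vertex[of "i + 1" t k n] assms(2)
    by (intro bexI[of _ "i * n + k"] bexI[of _ "(i + 1) * n + k"]) auto
next
  case (center k)
  then show ?thesis using web_vertex[of t t k n] web_vertex[of 0 t 0 n]
    by (intro bexI[of _ "t * n + k"] bexI[of _ 0]) auto
qed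

lemma web_Bob_graph:
  assumes t: "t \<ge> 2" and n: "n \<ge> 3"
  shows "Bob_graph (web_vertices t n) (web_edges t n)"
proof
  show edge: "\<exists>x\<in>web_vertices t n. \<exists>y\<in>web_vertices t n. x \<noteq> y \<and> e = {x, y}"
    if "e \<in> web_edges t n" for e
    using web_edge_vertices[OF that] n by simp
  have "web_edges t n \<subseteq> Pow (web_vertices t n)" using edge by blast
  then show fin: "finite (web_edges t n)"
    by (rule finite_subset) (simp add: web_vertices_def)
  \<comment> \<open>The \<open>n\<close> edges at the pendent vertices already provide three
    edges.\<close>
  have "{k, n + k} \<in> web_edges t n" if "k \<in> {1..n}" for k
  proof -
    have "{0 * n + k, (0 + 1) * n + k} \<in> web_path_edges t n"
      unfolding web_path_edges_def using that t by (intro UnI1 CollectI exI conjI refl) auto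
    then show ?thesis by (simp add: web_edges_def)
  qed
  then have "(\<lambda>k. {k, n + k}) ` {1..n} \<subseteq> web_edges t n" by blast
  moreover have "inj_on (\<lambda>k. {k, n + k}) {1..n}"
    by (auto simp: inj_on_def doubleton_eq_iff)
  ultimately have "card {1..n} \<le> card (web_edges t n)"
    using fin card_inj_on_le by blast
  then show "card (web_edges t n) \<ge> 3" using n by simp
  have isol: "c \<in> web_vertices t n - L \<and> (\<forall>x\<in>L. {c, x} \<notin> web_edges t n)"
    if "c \<in> {0..n}" "closed_nbhd t n c \<inter> L = {}" for c L
  proof -
    have "x \<in> closed_nbhd t n c" if "{c, x} \<in> web_edges t n" for x
      using that web_center_edge[of n x t] web_pendent_edge[of t c n x] n t \<open>c \<in> {0..n}\<close>
      by (cases "c = 0") (auto simp: closed_nbhd_def)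
    moreover have "c \<in> closed_nbhd t n c" by (simp add: closed_nbhd_def)
    moreover have "c \<in> web_vertices t n" using web_vertex[of 0 t c n] \<open>c \<in> {0..n}\<close> by simp
    ultimately show ?thesis using that(2) by blast
  qed
  show "\<exists>u\<in>web_vertices t n - L. \<forall>x\<in>L. {u, x} \<notin> web_edges t n"
    if L: "finite L" "card L \<le> 3" for L
  proof -
    obtain c where "c \<in> {0..n}" "closed_nbhd t n c \<inter> L = {}"
      \<comment> \<open>There are \<open>n + 1 \<ge> 4\<close> disjoint sets against at most three
        vertices in \<open>L\<close>, so the center is counted as well.\<close>
      using closed_nbhd_avoiding[OF t, of n "{0..n}" L] L n by auto
    then show ?thesis using isol by blast
  qed
  show "\<exists>p\<in>web_vertices t n - L. (\<forall>x\<in>L. {p, x} \<notin> web_edges t n) \<and>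
          (\<exists>w. \<forall>x. {p, x} \<in> web_edges t n \<longrightarrow> x = w)"
    if L: "finite L" "card L \<le> 1" for L
  proof -
    obtain c where c: "c \<in> {1..n}" "closed_nbhd t n c \<inter> L = {}"
      \<comment> \<open>The center is left out here, since the chosen vertex must be a leaf.\<close>
      using closed_nbhd_avoiding[OF t, of n "{1..n}" L] L n by auto
    then have "\<forall>x. {c, x} \<in> web_edges t n \<longrightarrow> x = n + c"
      using web_pendent_edge[of t c n] t by simp
    moreover have "c \<in> {0..n}" using c by simp
    ultimately show ?thesis using isol[of c L] c(2) by blast
  qed
qed

theorem theorem10:
  fixes t n :: nat
  assumes "t \<ge> 2" and "n \<ge> 3"
  shows "\<forall>first. \<exists>\<sigma>.
    winning_strategy_for_Bob (web_vertices t n) (web_edges t n) first \<sigma>"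
  using Bob_graph.Bob_wins[OF web_Bob_graph[OF assms]] ..

end
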